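(* Let $d$ be a positive integer such that $d+1$ is prime, and let $G$ be a $d$-degenerate graph. Let $v_1,v_2,\dots,v_n$ be an ordering of $V(G)$ such that each $v_i$ has $d^-(v_i)\le d$ backward neighbours (neighbours $v_j$ with $j<i$). Then there is a $(1,2)$-choosable graph $G'$ obtained from $G$ by adding, for each $i$, at most $d-d^-(v_i)$ new vertices of degree $1$ adjacent to $v_i$.
   Context: Graphs are finite and simple. A graph is $d$-degenerate if every subgraph has a vertex of degree at most $d$. $E(v)$ is the set of edges incident to $v$. A total weighting of $G$ is a map $\phi: V(G)\cup E(G)\to \mathbb{R}$; it is proper if for every edge $uv$, $\sum_{e\in E(u)}\phi(e)+\phi(u) \ne \sum_{e\in E(v)}\phi(e)+\phi(v)$. $G$ is $(k,k')$-choosable if for every assignment $L$ of a set $L(v)$ of $k$ real numbers to each vertex $v$ and a set $L(e)$ of $k'$ real numbers to each edge $e$, there is a proper total weighting $\phi$ with $\phi(z)\in L(z)$ for all $z\in V(G)\cup E(G)$. *)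

theory Defs
  imports Complex_Main "HOL-Computational_Algebra.Primes"
begin

type_synonym 'a graph = "'a set \<times> 'a set set"

abbreviation verts :: "'a graph \<Rightarrow> 'a set" where "verts G \<equiv> fst G"

abbreviation edges :: "'a graph \<Rightarrow> 'a set set" where "edges G \<equiv> snd G"

definition simple_graph :: "'a graph \<Rightarrow> bool" where
  "simple_graph G \<longleftrightarrow>
     finite (verts G) \<and> (\<forall>e \<in> edges G. e \<subseteq> verts G \<and> card e = 2)"

definition subgraph :: "'a graph \<Rightarrow> 'a graph \<Rightarrow> bool" where
  "subgraph H G \<longleftrightarrow>
     simple_graph H \<and> verts H \<subseteq> verts G \<and> edges H \<subseteq> edges G"

definition incident_edges :: "'a graph \<Rightarrow> 'a \<Rightarrow> 'a set set" where
  "incident_edges G v = {e \<in> edges G. v \<in> e}"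

definition vertex_degree :: "'a graph \<Rightarrow> 'a \<Rightarrow> nat" where
  "vertex_degree G v = card (incident_edges G v)"

text \<open>Only subgraphs with at least one vertex are considered; the empty graph has no
  vertex of any degree.\<close>

definition degenerate :: "nat \<Rightarrow> 'a graph \<Rightarrow> bool" where
  "degenerate d G \<longleftrightarrow>
     (\<forall>H. subgraph H G \<and> verts H \<noteq> {} \<longrightarrow> (\<exists>v \<in> verts H. vertex_degree H v \<le> d))"

definition vertex_ordering :: "'a graph \<Rightarrow> 'a list \<Rightarrow> bool" where
  "vertex_ordering G vs \<longleftrightarrow> distinct vs \<and> set vs = verts G"

definition back_degree :: "'a graph \<Rightarrow> 'a list \<Rightarrow> nat \<Rightarrow> nat" where
  "back_degree G vs i = card {vs ! j |j. j < i \<and> {vs ! j, vs ! i} \<in> edges G}"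

text \<open>A total weighting is a function on the disjoint union of vertices (\<open>Inl\<close>) and
  edges (\<open>Inr\<close>); its values outside \<open>verts G <+> edges G\<close> are irrelevant.\<close>

definition vertex_sum :: "'a graph \<Rightarrow> ('a + 'a set \<Rightarrow> real) \<Rightarrow> 'a \<Rightarrow> real" where
  "vertex_sum G \<phi> v = (\<Sum>e \<in> incident_edges G v. \<phi> (Inr e)) + \<phi> (Inl v)"

definition proper_total_weighting :: "'a graph \<Rightarrow> ('a + 'a set \<Rightarrow> real) \<Rightarrow> bool" where
  "proper_total_weighting G \<phi> \<longleftrightarrow>
     (\<forall>u v. {u, v} \<in> edges G \<longrightarrow> vertex_sum G \<phi> u \<noteq> vertex_sum G \<phi> v)"

definition total_choosable :: "nat \<Rightarrow> nat \<Rightarrow> 'a graph \<Rightarrow> bool" where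
  "total_choosable k k' G \<longleftrightarrow>
     (\<forall>L :: 'a + 'a set \<Rightarrow> real set.
        (\<forall>v \<in> verts G. finite (L (Inl v)) \<and> card (L (Inl v)) = k) \<and>
        (\<forall>e \<in> edges G. finite (L (Inr e)) \<and> card (L (Inr e)) = k') \<longrightarrow>
        (\<exists>\<phi>. proper_total_weighting G \<phi> \<and> (\<forall>z \<in> verts G <+> edges G. \<phi> z \<in> L z)))"

text \<open>The graph obtained by attaching \<open>m v\<close> new vertices \<open>Inr (v, 0), \<dots>, Inr (v, m v - 1)\<close>
  of degree 1 to each vertex \<open>v\<close>. The sum type provides the new vertices even when
  \<open>verts G\<close> exhausts its type.\<close>

definition add_leaves :: "('a \<Rightarrow> nat) \<Rightarrow> 'a graph \<Rightarrow> ('a + 'a \<times> nat) graph" where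
  "add_leaves m G =
     (Inl ` verts G \<union> {Inr (v, j) |v j. v \<in> verts G \<and> j < m v},
      (\<lambda>e. Inl ` e) ` edges G \<union> {{Inl v, Inr (v, j)} |v j. v \<in> verts G \<and> j < m v})"

lemma simple_graph_add_leaves:
  assumes "simple_graph G"
  shows "simple_graph (add_leaves m G)"
proof -
  have "{Inr (v, j) |v j. v \<in> verts G \<and> j < m v}
      = (Inr ` (SIGMA v:verts G. {..<m v}) :: ('a + 'a \<times> nat) set)"
    by auto
  then have "finite (verts (add_leaves m G))"
    using assms by (simp add: add_leaves_def simple_graph_def)
  moreover have "card (Inl ` e :: ('a + 'a \<times> nat) set) = card e" for e :: "'a set"
    by (simp add: card_image)
  ultimately show ?thesis
    using assms by (fastforce simp: simple_graph_def add_leaves_def)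
qed

lemma degree_new_vertex:
  assumes "v \<in> verts G" "j < m v"
  shows "vertex_degree (add_leaves m G) (Inr (v, j)) = 1"
proof -
  have "incident_edges (add_leaves m G) (Inr (v, j)) = {{Inl v, Inr (v, j)}}"
    using assms by (auto simp: incident_edges_def add_leaves_def)
  then show ?thesis
    by (simp add: vertex_degree_def)
qed

end

theory Submission
  imports Defs "HOL-Combinatorics.Permutations"
begin

text \<open>
  By Ryser's formula, the permanent of the matrix of differences of vertex sums (rows and columns
  indexed by the edges) is an alternating sum, over the choices from 2-element edge lists, of
  products that vanish unless the weighting is proper. Hence it suffices to make this permanent
  nonzero.

  Attach to each vertex \<open>v\<close> exactly \<open>s v = d - d\<^sup>-(v)\<close> half-edges, that is, indices whose row and
  column forms are both the vertex \<open>v\<close> itself. A half-edge differs from a leaf edge only in its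
  diagonal entry, which is 1 instead of 0. Expanding along these diagonal entries, the permanent
  with all half-edges is the sum, over the sets of half-edges to be removed, of the permanents of
  the graphs in which the remaining half-edges are leaf edges. So it suffices that the former is
  nonzero, and this holds modulo the prime \<open>d + 1\<close>: expanding the entries, every assignment of
  indices to vertices contributes a multiple of \<open>k!\<close> for each of its fibre sizes \<open>k\<close>, so only fibre
  sizes at most \<open>d\<close> matter. There are \<open>n d\<close> indices, so all fibres have size exactly \<open>d\<close>, and the
  only such assignment sends each edge to its later endpoint. Its contribution is \<open>\<plusminus>(d!)\<^sup>n\<close>.
\<close>

section \<open>Permanents and Ryser's formula\<close>

text \<open>Index sets are arbitrary, so that deleting indices means passing to a smaller set. The
  ring is left open because divisibility is argued over \<open>int\<close> while weights live in
  \<open>real\<close>.\<close>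

definition permanent :: "('i \<Rightarrow> 'i \<Rightarrow> 'b::comm_ring_1) \<Rightarrow> 'i set \<Rightarrow> 'b" where
  "permanent A I = (\<Sum>\<sigma> | \<sigma> permutes I. \<Prod>i\<in>I. A i (\<sigma> i))"

lemma permanent_cong:
  assumes "\<And>i j. i \<in> I \<Longrightarrow> j \<in> I \<Longrightarrow> A i j = B i j"
  shows "permanent A I = permanent B I"
  unfolding permanent_def
  by (intro sum.cong prod.cong refl assms) (auto simp: permutes_in_image)

lemma of_int_permanent: "of_int (permanent A I) = permanent (\<lambda>i j. of_int (A i j)) I"
  by (simp add: permanent_def)

text \<open>A permutation meets every column exactly once, so each of its products carries all the
  factors \<open>b j\<close>.\<close>

lemma permanent_mult_columns:
  fixes A :: "'i \<Rightarrow> 'i \<Rightarrow> 'b::comm_ring_1"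
  shows "permanent (\<lambda>i j. A i j * b j) I = permanent A I * prod b I"
proof -
  have "(\<Prod>i\<in>I. A i (\<sigma> i) * b (\<sigma> i)) = (\<Prod>i\<in>I. A i (\<sigma> i)) * prod b I" if "\<sigma> permutes I" for \<sigma>
    using prod.permute[OF that, of b] by (simp add: prod.distrib o_def)
  then show ?thesis
    by (simp add: permanent_def sum_distrib_right)
qed

text \<open>When the product is expanded, each row picks either its constant \<open>c i\<close> or a
  column. Inclusion-exclusion over \<open>U\<close> retains only the selections that use every
  column. With as many rows as columns these are the permutations, so the constants
  disappear.\<close>

lemma alternating_sum_eq_permanent:
  fixes B :: "'i \<Rightarrow> 'i \<Rightarrow> 'b::comm_ring_1"
  assumes "finite I"
  shows "(\<Sum>U\<in>Pow I. (-1) ^ card (I - U) * (\<Prod>i\<in>I. (\<Sum>j\<in>U. B i j) + c i)) = permanent B I"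
proof -
  \<comment> \<open>A selection sends row \<open>i\<close> to \<open>None\<close> for the constant
    and to \<open>Some j\<close> for column \<open>j\<close>; \<open>S f\<close> collects the
    columns used.\<close>
  define O' where "O' = insert None (Some ` I)"
  define w where "w = (\<lambda>i y. case y of None \<Rightarrow> c i | Some j \<Rightarrow> B i j)"
  define S where "S f = {j. Some j \<in> f ` I}" for f :: "'i \<Rightarrow> 'i option"
  have finO: "finite O'" using assms by (simp add: O'_def)
  have finP: "finite (I \<rightarrow>\<^sub>E O')" using assms finO by (intro finite_PiE) auto
  \<comment> \<open>A selection occurs in the product for \<open>U\<close> exactly if all columns it
    uses lie in \<open>U\<close>.\<close>
  have expand: "(\<Prod>i\<in>I. (\<Sum>j\<in>U. B i j) + c i)
      = (\<Sum>f\<in>I \<rightarrow>\<^sub>E O'. if S f \<subseteq> U then \<Prod>i\<in>I. w i (f i) else 0)" if U: "U \<subseteq> I" for U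
  proof -
    have "(\<Sum>j\<in>U. B i j) + c i = (\<Sum>y\<in>O'. if y \<in> insert None (Some ` U) then w i y else 0)" for i
    proof -
      have "(\<Sum>y\<in>O'. if y \<in> insert None (Some ` U) then w i y else 0)
          = (\<Sum>y\<in>insert None (Some ` U). w i y)"
        using finO U by (intro sum.mono_neutral_cong_right) (auto simp: O'_def)
      also have "\<dots> = c i + (\<Sum>y\<in>Some ` U. w i y)"
        using finite_subset[OF U assms] by (subst sum.insert) (auto simp: w_def)
      also have "(\<Sum>y\<in>Some ` U. w i y) = (\<Sum>j\<in>U. B i j)"
        by (subst sum.reindex) (auto simp: w_def)
      finally show ?thesis by simp
    qed
    then have "(\<Prod>i\<in>I. (\<Sum>j\<in>U. B i j) + c i)
        = (\<Sum>f\<in>I \<rightarrow>\<^sub>E O'. \<Prod>i\<in>I. if f i \<in> insert None (Some ` U) then w i (f i) else 0)"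
      using assms finO by (simp only: prod_sum_PiE)
    also have "\<dots> = (\<Sum>f\<in>I \<rightarrow>\<^sub>E O'. if S f \<subseteq> U then \<Prod>i\<in>I. w i (f i) else 0)"
    proof (intro sum.cong refl)
      fix f assume f: "f \<in> I \<rightarrow>\<^sub>E O'"
      have iff: "S f \<subseteq> U \<longleftrightarrow> (\<forall>i\<in>I. f i \<in> insert None (Some ` U))"
      proof
        assume S: "S f \<subseteq> U"
        show "\<forall>i\<in>I. f i \<in> insert None (Some ` U)"
        proof
          fix i assume i: "i \<in> I"
          show "f i \<in> insert None (Some ` U)"
          proof (cases "f i")
            case (Some j)
            then have "j \<in> S f" using i by (force simp: S_def)
            then show ?thesis using S Some by auto
          qed simp
        qed
      next
        assume "\<forall>i\<in>I. f i \<in> insert None (Some ` U)"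
        then show "S f \<subseteq> U" by (auto simp: S_def)
      qed
      show "(\<Prod>i\<in>I. if f i \<in> insert None (Some ` U) then w i (f i) else 0)
          = (if S f \<subseteq> U then \<Prod>i\<in>I. w i (f i) else 0)"
      proof (cases "S f \<subseteq> U")
        case True
        then show ?thesis using iff by simp
      next
        case False
        then obtain i where "i \<in> I" "f i \<notin> insert None (Some ` U)" using iff by blast
        then have "(\<Prod>i\<in>I. if f i \<in> insert None (Some ` U) then w i (f i) else 0) = 0"
          using assms(1) by (intro prod_zero) (auto intro!: bexI[of _ i])
        then show ?thesis using False by simp
      qed
    qed
    finally show ?thesis .
  qed
  have alternating: "(\<Sum>U\<in>Pow I. if T \<subseteq> U then (-1) ^ card (I - U) else 0)
      = (if I \<subseteq> T then 1 else (0::'b))" if T: "T \<subseteq> I" for T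
  proof -
    \<comment> \<open>The sign is distributed over the \<open>j\<close> outside \<open>U\<close>,
      with a factor 0 if \<open>j\<close> lies in \<open>T\<close>. The sum over \<open>U\<close> is
      then the expansion of a product whose factors are 1 on \<open>T\<close> and
      \<open>1 - 1\<close> elsewhere.\<close>
    have "(\<Sum>U\<in>Pow I. if T \<subseteq> U then (-1) ^ card (I - U) else (0::'b))
        = (\<Sum>U\<in>Pow I. (\<Prod>j\<in>U. 1) * (\<Prod>j\<in>I - U. if j \<in> T then 0 else -1))"
    proof (intro sum.cong refl)
      fix U assume U: "U \<in> Pow I"
      show "(if T \<subseteq> U then (-1) ^ card (I - U) else (0::'b))
          = (\<Prod>j\<in>U. 1) * (\<Prod>j\<in>I - U. if j \<in> T then 0 else -1)"
      proof (cases "T \<subseteq> U")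
        case True
        then have "(\<Prod>j\<in>I - U. if j \<in> T then 0 else -1 :: 'b) = (\<Prod>j\<in>I - U. -1)"
          by (intro prod.cong) auto
        then show ?thesis using True by simp
      next
        case False
        then obtain j where "j \<in> T" "j \<notin> U" by blast
        then have "(\<Prod>j\<in>I - U. if j \<in> T then 0 else -1 :: 'b) = 0"
          using assms T by (intro prod_zero) auto
        then show ?thesis using False by simp
      qed
    qed
    also have "\<dots> = (\<Prod>j\<in>I. 1 + (if j \<in> T then 0 else -1))"
      using assms by (simp only: prod_add)
    also have "\<dots> = (if I \<subseteq> T then 1 else 0)"
    proof (cases "I \<subseteq> T")
      case True
      then show ?thesis by (auto intro!: prod.neutral)
    next
      case False
      then show ?thesis using assms by (auto intro!: prod_zero)
    qed
    finally show ?thesis .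
  qed
  have "(\<Sum>U\<in>Pow I. (-1) ^ card (I - U) * (\<Prod>i\<in>I. (\<Sum>j\<in>U. B i j) + c i))
      = (\<Sum>U\<in>Pow I. \<Sum>f\<in>I \<rightarrow>\<^sub>E O'. 
           (if S f \<subseteq> U then (-1) ^ card (I - U) else 0) * (\<Prod>i\<in>I. w i (f i)))"
    by (intro sum.cong refl) (auto simp: expand sum_distrib_left intro!: sum.cong)
  also have "\<dots> = (\<Sum>f\<in>I \<rightarrow>\<^sub>E O'. (if I \<subseteq> S f then 1 else 0) * (\<Prod>i\<in>I. w i (f i)))"
    by (subst sum.swap, intro sum.cong refl, subst sum_distrib_right[symmetric], subst alternating)
       (auto simp: S_def O'_def PiE_def Pi_def)
  also have "\<dots> = (\<Sum>f\<in>{f \<in> I \<rightarrow>\<^sub>E O'. I \<subseteq> S f}. \<Prod>i\<in>I. w i (f i))"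
    using finP by (intro sum.mono_neutral_cong_right) auto
  also have "\<dots> = (\<Sum>\<sigma> | \<sigma> permutes I. \<Prod>i\<in>I. w i (Some (\<sigma> i)))"
  proof (rule sum.reindex_bij_witness
      [where j = "\<lambda>f i. if i \<in> I then the (f i) else i" and i = "\<lambda>\<sigma>. \<lambda>i\<in>I. Some (\<sigma> i)"])
    fix f assume "f \<in> {f \<in> I \<rightarrow>\<^sub>E O'. I \<subseteq> S f}"
    then have f: "f \<in> I \<rightarrow>\<^sub>E O'" and onto: "I \<subseteq> S f" by auto
    \<comment> \<open>Only \<open>card I\<close> rows are available to hit all columns, so no column
      is hit twice and no row is left for \<open>None\<close>.\<close>
    have "Some ` I \<subseteq> f ` I" using onto by (auto simp: S_def)
    moreover have "card (f ` I) \<le> card (Some ` I)"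
      using assms by (simp add: card_image card_image_le)
    ultimately have im: "f ` I = Some ` I"
      using assms by (metis card_seteq finite_imageI)
    then have inj: "inj_on f I"
      using assms by (intro eq_card_imp_inj_on) (simp_all add: card_image)
    have some: "f i = Some (the (f i))" "the (f i) \<in> I" if "i \<in> I" for i
      using im that by (metis (no_types, lifting) image_iff option.sel)+
    have "inj_on (\<lambda>i. if i \<in> I then the (f i) else i) I"
      by (rule inj_onI) (metis inj inj_onD some(1))
    then show "(\<lambda>i. if i \<in> I then the (f i) else i) \<in> {\<sigma>. \<sigma> permutes I}"
      using assms some(2) by (auto intro!: inj_imp_permutes)
    show "(\<lambda>i\<in>I. Some (if i \<in> I then the (f i) else i)) = f"
      using f some(1) by (auto simp: fun_eq_iff PiE_def extensional_def)
    show "(\<Prod>i\<in>I. w i (Some (if i \<in> I then the (f i) else i))) = (\<Prod>i\<in>I. w i (f i))"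
      using some(1) by (intro prod.cong) auto
  next
    fix \<sigma> assume "\<sigma> \<in> {\<sigma>. \<sigma> permutes I}"
    then have \<sigma>: "\<sigma> permutes I" by simp
    show "(\<lambda>i. if i \<in> I then the ((\<lambda>i\<in>I. Some (\<sigma> i)) i) else i) = \<sigma>"
      using \<sigma> by (auto simp: fun_eq_iff permutes_not_in)
    have "j \<in> S (\<lambda>i\<in>I. Some (\<sigma> i))" if "j \<in> I" for j
    proof -
      have "j \<in> \<sigma> ` I" using permutes_image[OF \<sigma>] that by simp
      then show ?thesis by (auto simp: S_def image_iff)
    qed
    then show "(\<lambda>i\<in>I. Some (\<sigma> i)) \<in> {f \<in> I \<rightarrow>\<^sub>E O'. I \<subseteq> S f}"
      using \<sigma> by (auto simp: O'_def permutes_in_image)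
  qed
  finally show ?thesis by (simp add: w_def permanent_def)
qed

text \<open>Let \<open>U\<close> be the set of coordinates that take the second of their two values.
  The alternating sum over \<open>U\<close> of the products of the affine forms is the permanent
  times the differences within the lists. It is nonzero, so one of the products is nonzero. This is
  Alon's permanent lemma.\<close>

lemma permanent_nonzero_avoids_zeros:
  fixes A :: "'i \<Rightarrow> 'i \<Rightarrow> 'b::idom"
  assumes "finite I" and "permanent A I \<noteq> 0" and "\<And>j. j \<in> I \<Longrightarrow> card (S j) = 2"
  obtains x where "\<And>j. j \<in> I \<Longrightarrow> x j \<in> S j"
    and "\<And>i. i \<in> I \<Longrightarrow> (\<Sum>j\<in>I. A i j * x j) + c i \<noteq> 0"
proof -
  have "\<forall>j\<in>I. \<exists>a b. a \<noteq> b \<and> S j = {a, b}"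
    using assms(3) unfolding card_2_iff by blast
  then obtain a b where ab: "\<And>j. j \<in> I \<Longrightarrow> a j \<noteq> b j \<and> S j = {a j, b j}"
    by metis
  define x where "x U j = (if j \<in> U then b j else a j)" for U j
  \<comment> \<open>\<open>c'\<close> is the value at the base point \<open>a\<close>. Each
    \<open>j\<close> in \<open>U\<close> then adds its column times \<open>b j - a j\<close>, which
    is the shape required by Ryser's formula.\<close>
  define c' where "c' i = (\<Sum>j\<in>I. A i j * a j) + c i" for i
  have form: "(\<Sum>j\<in>I. A i j * x U j) + c i = (\<Sum>j\<in>U. A i j * (b j - a j)) + c' i"
    if "U \<subseteq> I" for U i
  proof -
    have "(\<Sum>j\<in>U. A i j * (b j - a j)) = (\<Sum>j\<in>I. if j \<in> U then A i j * (b j - a j) else 0)"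
      using assms(1) that by (intro sum.mono_neutral_cong_left) auto
    then have "(\<Sum>j\<in>U. A i j * (b j - a j)) + (\<Sum>j\<in>I. A i j * a j) = (\<Sum>j\<in>I. A i j * x U j)"
      by (auto simp: x_def sum.distrib[symmetric] algebra_simps intro!: sum.cong)
    then show ?thesis by (simp add: c'_def algebra_simps)
  qed
  have "(\<Prod>j\<in>I. b j - a j) \<noteq> 0"
    using assms(1) by (auto dest: ab)
  then have "permanent (\<lambda>i j. A i j * (b j - a j)) I \<noteq> 0"
    using assms(2) by (simp add: permanent_mult_columns)
  then have "(\<Sum>U\<in>Pow I. (-1) ^ card (I - U) *
      (\<Prod>i\<in>I. (\<Sum>j\<in>U. A i j * (b j - a j)) + c' i)) \<noteq> 0"
    using alternating_sum_eq_permanent[OF assms(1), of "\<lambda>i j. A i j * (b j - a j)" c'] by simp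
  then obtain U where U: "U \<subseteq> I" and
    "(-1) ^ card (I - U) * (\<Prod>i\<in>I. (\<Sum>j\<in>U. A i j * (b j - a j)) + c' i) \<noteq> 0"
    by (metis (no_types, lifting) Pow_iff sum.neutral)
  then have "(\<Prod>i\<in>I. (\<Sum>j\<in>I. A i j * x U j) + c i) \<noteq> 0"
    by (auto simp: form)
  then have "\<And>i. i \<in> I \<Longrightarrow> (\<Sum>j\<in>I. A i j * x U j) + c i \<noteq> 0"
    using assms(1) by (simp add: prod_zero_iff)
  moreover have "x U j \<in> S j" if "j \<in> I" for j
    using ab[OF that] by (simp add: x_def)
  ultimately show ?thesis using that by blast
qed

text \<open>The permutations are grouped by the set \<open>F\<close> of their fixed points in \<open>H\<close>.\<close>

lemma permanent_unit_diagonal: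
  fixes A :: "'i \<Rightarrow> 'i \<Rightarrow> 'b::comm_ring_1"
  assumes "finite I" "H \<subseteq> I" and diag: "\<And>h. h \<in> H \<Longrightarrow> A h h = 1"
  shows "permanent A I
    = (\<Sum>F\<in>Pow H. permanent (\<lambda>i j. if i = j \<and> i \<in> H then 0 else A i j) (I - F))"
proof -
  define A' where "A' = (\<lambda>i j. if i = j \<and> i \<in> H then 0 else A i j)"
  have finH: "finite H" using assms finite_subset by blast
  have "permanent A I = (\<Sum>F\<in>Pow H. \<Sum>\<sigma>\<in>{\<sigma> \<in> {\<sigma>. \<sigma> permutes I}. {h \<in> H. \<sigma> h = h} = F}.
      \<Prod>i\<in>I. A i (\<sigma> i))"
    unfolding permanent_def
    by (rule sum.group[symmetric]) (use assms finH in \<open>auto simp: finite_permutations\<close>)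
  also have "\<dots> = (\<Sum>F\<in>Pow H. permanent A' (I - F))"
  proof (intro sum.cong refl)
    fix F assume F: "F \<in> Pow H"
    have "permanent A' (I - F) = (\<Sum>\<sigma>\<in>{\<sigma> \<in> {\<sigma>. \<sigma> permutes I}. {h \<in> H. \<sigma> h = h} = F}.
      \<Prod>i\<in>I - F. A' i (\<sigma> i))"
      unfolding permanent_def
    proof (intro sum.mono_neutral_right ballI)
      show "finite {\<sigma>. \<sigma> permutes (I - F)}"
        using assms by (simp add: finite_permutations)
      show "{\<sigma> \<in> {\<sigma>. \<sigma> permutes I}. {h \<in> H. \<sigma> h = h} = F} \<subseteq> {\<sigma>. \<sigma> permutes (I - F)}"
        by (auto intro: permutes_superset)
      \<comment> \<open>Such a permutation fixes some further \<open>h\<close> in \<open>H\<close>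
        outside \<open>F\<close>, where the diagonal entry of \<open>A'\<close> is 0.\<close>
      fix \<sigma> assume "\<sigma> \<in> {\<sigma>. \<sigma> permutes (I - F)} - {\<sigma> \<in> {\<sigma>. \<sigma> permutes I}. {h \<in> H. \<sigma> h = h} = F}"
      then have \<sigma>: "\<sigma> permutes (I - F)" and ne: "{h \<in> H. \<sigma> h = h} \<noteq> F"
        using permutes_subset[of \<sigma> "I - F" I] by auto
      have "\<sigma> h = h" if "h \<in> F" for h using \<sigma> that by (simp add: permutes_def)
      then obtain h where h: "h \<in> H" "\<sigma> h = h" "h \<notin> F" using ne F by blast
      then have "A' h (\<sigma> h) = 0" "h \<in> I - F" using assms by (auto simp: A'_def)
      then show "(\<Prod>i\<in>I - F. A' i (\<sigma> i)) = 0" using assms(1) by (intro prod_zero) auto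
    qed
    also have "\<dots> = (\<Sum>\<sigma>\<in>{\<sigma> \<in> {\<sigma>. \<sigma> permutes I}. {h \<in> H. \<sigma> h = h} = F}. \<Prod>i\<in>I. A i (\<sigma> i))"
    proof (intro sum.cong refl)
      fix \<sigma> assume \<sigma>: "\<sigma> \<in> {\<sigma> \<in> {\<sigma>. \<sigma> permutes I}. {h \<in> H. \<sigma> h = h} = F}"
      \<comment> \<open>All fixed points in \<open>H\<close> lie in \<open>F\<close>, so no altered
        entry is used; the rows in \<open>F\<close> contribute diagonal entries 1.\<close>
      have "(\<Prod>i\<in>I - F. A' i (\<sigma> i)) = (\<Prod>i\<in>I - F. A i (\<sigma> i))"
        using \<sigma> by (intro prod.cong) (auto simp: A'_def)
      also have "\<dots> = (\<Prod>i\<in>I. A i (\<sigma> i))"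
        using \<sigma> assms by (intro prod.mono_neutral_left) auto
      finally show "(\<Prod>i\<in>I - F. A' i (\<sigma> i)) = (\<Prod>i\<in>I. A i (\<sigma> i))" .
    qed
    finally show "(\<Sum>\<sigma>\<in>{\<sigma> \<in> {\<sigma>. \<sigma> permutes I}. {h \<in> H. \<sigma> h = h} = F}. \<Prod>i\<in>I. A i (\<sigma> i))
      = permanent A' (I - F)" by simp
  qed
  finally show ?thesis by (simp add: A'_def)
qed

section \<open>Counting permutations, and the permanent modulo a prime\<close>

text \<open>Such a permutation amounts to an independent choice of a permutation of each fibre of
  \<open>g\<close>.\<close>

lemma card_fiber_preserving_permutations:
  assumes "finite I" "finite V" "g ` I \<subseteq> V"
  shows "card {\<sigma>. \<sigma> permutes I \<and> (\<forall>i\<in>I. g (\<sigma> i) = g i)} = (\<Prod>v\<in>V. fact (card {i \<in> I. g i = v}))"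
proof -
  define pack where "pack \<sigma> = (\<lambda>v\<in>V. \<lambda>i. if i \<in> I \<and> g i = v then \<sigma> i else i)" for \<sigma> :: "'a \<Rightarrow> 'a"
  define unpack where "unpack \<pi> = (\<lambda>i. if i \<in> I then \<pi> (g i) i else i)" for \<pi> :: "'b \<Rightarrow> 'a \<Rightarrow> 'a"
  have "bij_betw pack {\<sigma>. \<sigma> permutes I \<and> (\<forall>i\<in>I. g (\<sigma> i) = g i)}
      (\<Pi>\<^sub>E v\<in>V. {\<pi>. \<pi> permutes {i \<in> I. g i = v}})"
  proof (rule bij_betw_byWitness[where f' = unpack])
    show "\<forall>\<sigma>\<in>{\<sigma>. \<sigma> permutes I \<and> (\<forall>i\<in>I. g (\<sigma> i) = g i)}. unpack (pack \<sigma>) = \<sigma>"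
      using assms(3) by (auto simp: unpack_def pack_def fun_eq_iff permutes_not_in)
    show "\<forall>\<pi>\<in>\<Pi>\<^sub>E v\<in>V. {\<pi>. \<pi> permutes {i \<in> I. g i = v}}. pack (unpack \<pi>) = \<pi>"
    proof (intro ballI ext)
      fix \<pi> v i assume \<pi>: "\<pi> \<in> (\<Pi>\<^sub>E v\<in>V. {\<pi>. \<pi> permutes {i \<in> I. g i = v}})"
      show "pack (unpack \<pi>) v i = \<pi> v i"
      proof (cases "v \<in> V")
        case True
        then have "\<pi> v permutes {i \<in> I. g i = v}" using \<pi> by auto
        then show ?thesis using True by (auto simp: pack_def unpack_def permutes_def)
      next
        case False
        then show ?thesis using \<pi> by (auto simp: pack_def PiE_def extensional_def)
      qed
    qed
    show "pack ` {\<sigma>. \<sigma> permutes I \<and> (\<forall>i\<in>I. g (\<sigma> i) = g i)}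
        \<subseteq> (\<Pi>\<^sub>E v\<in>V. {\<pi>. \<pi> permutes {i \<in> I. g i = v}})"
    proof (rule image_subsetI)
      fix \<sigma> assume \<sigma>: "\<sigma> \<in> {\<sigma>. \<sigma> permutes I \<and> (\<forall>i\<in>I. g (\<sigma> i) = g i)}"
      have "(\<lambda>i. if i \<in> I \<and> g i = v then \<sigma> i else i) permutes {i \<in> I. g i = v}" for v
      proof (rule inj_imp_permutes)
        have "inj \<sigma>" using \<sigma> permutes_inj by blast
        then show "inj_on (\<lambda>i. if i \<in> I \<and> g i = v then \<sigma> i else i) {i \<in> I. g i = v}"
          by (intro inj_onI) (simp add: inj_eq)
      qed (use \<sigma> assms(1) in \<open>auto simp: permutes_in_image\<close>)
      then show "pack \<sigma> \<in> (\<Pi>\<^sub>E v\<in>V. {\<pi>. \<pi> permutes {i \<in> I. g i = v}})"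
        by (auto simp: pack_def)
    qed
    show "unpack ` (\<Pi>\<^sub>E v\<in>V. {\<pi>. \<pi> permutes {i \<in> I. g i = v}})
        \<subseteq> {\<sigma>. \<sigma> permutes I \<and> (\<forall>i\<in>I. g (\<sigma> i) = g i)}"
    proof (rule image_subsetI)
      fix \<pi> assume \<pi>: "\<pi> \<in> (\<Pi>\<^sub>E v\<in>V. {\<pi>. \<pi> permutes {i \<in> I. g i = v}})"
      have perm: "\<pi> (g i) permutes {j \<in> I. g j = g i}" if "i \<in> I" for i
        using \<pi> assms(3) that by auto
      have mem: "\<pi> (g i) i \<in> I" "g (\<pi> (g i) i) = g i" if "i \<in> I" for i
        using permutes_in_image[OF perm[OF that], of i] that by auto
      have "inj_on (unpack \<pi>) I"
      proof (rule inj_onI)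
        fix i j assume ij: "i \<in> I" "j \<in> I" "unpack \<pi> i = unpack \<pi> j"
        then have eq: "\<pi> (g i) i = \<pi> (g j) j" by (simp add: unpack_def)
        then have "g i = g j" using mem(2) ij by metis
        then show "i = j" using eq permutes_inj[OF perm[OF ij(1)]] by (auto dest: injD)
      qed
      then have "unpack \<pi> permutes I"
        using assms(1) mem by (intro inj_imp_permutes) (auto simp: unpack_def)
      then show "unpack \<pi> \<in> {\<sigma>. \<sigma> permutes I \<and> (\<forall>i\<in>I. g (\<sigma> i) = g i)}"
        using mem by (auto simp: unpack_def)
    qed
  qed
  then have "card {\<sigma>. \<sigma> permutes I \<and> (\<forall>i\<in>I. g (\<sigma> i) = g i)}
      = card (\<Pi>\<^sub>E v\<in>V. {\<pi>. \<pi> permutes {i \<in> I. g i = v}})"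
    by (rule bij_betw_same_card)
  also have "\<dots> = (\<Prod>v\<in>V. card {\<pi>. \<pi> permutes {i \<in> I. g i = v}})"
    using assms(2) by (rule card_PiE)
  also have "\<dots> = (\<Prod>v\<in>V. fact (card {i \<in> I. g i = v}))"
    using assms(1) by (intro prod.cong refl card_permutations) auto
  finally show ?thesis .
qed

text \<open>Composition with one transporting permutation \<open>\<tau>\<close> maps the stabiliser
  of \<open>g\<close> bijectively onto the set counted here, which is therefore a coset.\<close>

lemma card_permutations_transporting:
  assumes "finite I" "finite V" "g ` I \<subseteq> V" and \<tau>: "\<tau> permutes I" "\<forall>i\<in>I. g (\<tau> i) = h i"
  shows "card {\<sigma>. \<sigma> permutes I \<and> (\<forall>i\<in>I. g (\<sigma> i) = h i)} = (\<Prod>v\<in>V. fact (card {i \<in> I. g i = v}))"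
proof -
  have "bij_betw (\<lambda>\<sigma>. \<sigma> \<circ> \<tau>) {\<sigma>. \<sigma> permutes I \<and> (\<forall>i\<in>I. g (\<sigma> i) = g i)}
     {\<sigma>. \<sigma> permutes I \<and> (\<forall>i\<in>I. g (\<sigma> i) = h i)}"
  proof (rule bij_betw_byWitness[where f' = "\<lambda>\<sigma>. \<sigma> \<circ> inv \<tau>"])
    have inv: "inv \<tau> permutes I" by (rule permutes_inv[OF \<tau>(1)])
    show "(\<lambda>\<sigma>. \<sigma> \<circ> inv \<tau>) ` {\<sigma>. \<sigma> permutes I \<and> (\<forall>i\<in>I. g (\<sigma> i) = h i)}
      \<subseteq> {\<sigma>. \<sigma> permutes I \<and> (\<forall>i\<in>I. g (\<sigma> i) = g i)}"
    proof (rule image_subsetI)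
      fix \<sigma> assume "\<sigma> \<in> {\<sigma>. \<sigma> permutes I \<and> (\<forall>i\<in>I. g (\<sigma> i) = h i)}"
      then have \<sigma>: "\<sigma> permutes I" "\<And>i. i \<in> I \<Longrightarrow> g (\<sigma> i) = h i" by auto
      have "g (\<sigma> (inv \<tau> i)) = g i" if "i \<in> I" for i
      proof -
        have "inv \<tau> i \<in> I" using permutes_in_image[OF inv] that by simp
        then have "g (\<sigma> (inv \<tau> i)) = g (\<tau> (inv \<tau> i))" using \<sigma>(2) \<tau>(2) by simp
        then show ?thesis by (simp add: permutes_inverses(1)[OF \<tau>(1)])
      qed
      moreover have "\<sigma> \<circ> inv \<tau> permutes I" using permutes_compose[OF inv \<sigma>(1)] .
      ultimately show "\<sigma> \<circ> inv \<tau> \<in> {\<sigma>. \<sigma> permutes I \<and> (\<forall>i\<in>I. g (\<sigma> i) = g i)}"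
        by simp
    qed
    show "(\<lambda>\<sigma>. \<sigma> \<circ> \<tau>) ` {\<sigma>. \<sigma> permutes I \<and> (\<forall>i\<in>I. g (\<sigma> i) = g i)}
      \<subseteq> {\<sigma>. \<sigma> permutes I \<and> (\<forall>i\<in>I. g (\<sigma> i) = h i)}"
      using \<tau> by (auto simp: permutes_in_image intro: permutes_compose)
  qed (auto simp: comp_assoc permutes_inv_o[OF \<tau>(1)])
  then have "card {\<sigma>. \<sigma> permutes I \<and> (\<forall>i\<in>I. g (\<sigma> i) = g i)}
     = card {\<sigma>. \<sigma> permutes I \<and> (\<forall>i\<in>I. g (\<sigma> i) = h i)}"
    by (rule bij_betw_same_card)
  then show ?thesis
    using card_fiber_preserving_permutations[OF assms(1-3)] by simp
qed

text \<open>The matrix factors through \<open>V\<close>. Once a summand \<open>g i\<close> is chosen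
  in each row, the row factors no longer depend on the permutation, which acts on the column factors
  only.\<close>

lemma permanent_product_expansion:
  fixes r c :: "'i \<Rightarrow> 'v \<Rightarrow> 'b::comm_ring_1"
  assumes "finite I" "finite V"
  shows "permanent (\<lambda>i j. \<Sum>v\<in>V. r i v * c j v) I
    = (\<Sum>g\<in>I \<rightarrow>\<^sub>E V. (\<Prod>i\<in>I. r i (g i)) * (\<Sum>\<sigma> | \<sigma> permutes I. \<Prod>j\<in>I. c j (g (\<sigma> j))))"
proof -
  have "permanent (\<lambda>i j. \<Sum>v\<in>V. r i v * c j v) I
      = (\<Sum>\<sigma> | \<sigma> permutes I. \<Sum>g\<in>I \<rightarrow>\<^sub>E V. \<Prod>i\<in>I. r i (g i) * c (\<sigma> i) (g i))"
    using assms by (simp add: permanent_def prod_sum_PiE)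
  also have "\<dots> = (\<Sum>g\<in>I \<rightarrow>\<^sub>E V. (\<Prod>i\<in>I. r i (g i)) *
      (\<Sum>\<sigma> | \<sigma> permutes I. \<Prod>i\<in>I. c (\<sigma> i) (g i)))"
    by (subst sum.swap) (simp add: prod.distrib sum_distrib_left)
  also have "\<dots> = (\<Sum>g\<in>I \<rightarrow>\<^sub>E V. (\<Prod>i\<in>I. r i (g i)) *
      (\<Sum>\<sigma> | \<sigma> permutes I. \<Prod>j\<in>I. c j (g (\<sigma> j))))"
  proof -
    have "(\<Sum>\<sigma> | \<sigma> permutes I. \<Prod>i\<in>I. c (\<sigma> i) (g i))
        = (\<Sum>\<sigma> | \<sigma> permutes I. \<Prod>j\<in>I. c j (g (\<sigma> j)))" for g
    proof -
      \<comment> \<open>Passing to inverses makes the composites \<open>g \<circ> \<sigma>\<close>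
        appear, by which the sum can be grouped.\<close>
      have "(\<Sum>\<sigma> | \<sigma> permutes I. \<Prod>i\<in>I. c (\<sigma> i) (g i))
        = (\<Sum>\<sigma> | \<sigma> permutes I. \<Prod>i\<in>I. c (inv \<sigma> i) (g i))"
        by (rule sum_permutations_inverse)
      also have "\<dots> = (\<Sum>\<sigma> | \<sigma> permutes I. \<Prod>j\<in>I. c j (g (\<sigma> j)))"
      proof (intro sum.cong refl)
        fix \<sigma> assume "\<sigma> \<in> {\<sigma>. \<sigma> permutes I}"
        then have \<sigma>: "\<sigma> permutes I" by simp
        show "(\<Prod>i\<in>I. c (inv \<sigma> i) (g i)) = (\<Prod>j\<in>I. c j (g (\<sigma> j)))"
          using prod.permute[OF \<sigma>, of "\<lambda>i. c (inv \<sigma> i) (g i)"]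
          by (simp add: o_def permutes_inverses(2)[OF \<sigma>])
      qed
      finally show ?thesis .
    qed
    then show ?thesis by simp
  qed
  finally show ?thesis .
qed

text \<open>The product depends on \<open>\<sigma>\<close> only through the composite
  \<open>h\<close> of \<open>g\<close> and \<open>\<sigma>\<close>. Grouping by \<open>h\<close>
  exposes the multiplicities, which carry the factorials.\<close>

lemma sum_over_permutations_by_composite:
  fixes C :: "('i \<Rightarrow> 'v) \<Rightarrow> 'b::comm_semiring_1"
  assumes "finite I" "finite V" and g: "g \<in> I \<rightarrow>\<^sub>E V"
  shows "(\<Sum>\<sigma> | \<sigma> permutes I. \<Prod>j\<in>I. c j (g (\<sigma> j)))
    = (\<Sum>h\<in>I \<rightarrow>\<^sub>E V. of_nat (card {\<sigma>. \<sigma> permutes I \<and> (\<forall>i\<in>I. g (\<sigma> i) = h i)}) * (\<Prod>j\<in>I. c j (h j)))"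
proof -
  have "(\<Sum>\<sigma> | \<sigma> permutes I. \<Prod>j\<in>I. c j (g (\<sigma> j)))
    = (\<Sum>h\<in>I \<rightarrow>\<^sub>E V. \<Sum>\<sigma>\<in>{\<sigma> \<in> {\<sigma>. \<sigma> permutes I}. (\<lambda>i\<in>I. g (\<sigma> i)) = h}. \<Prod>j\<in>I. c j (g (\<sigma> j)))"
    using assms
    by (intro sum.group[symmetric]) (auto simp: finite_permutations permutes_in_image intro!: finite_PiE)
  also have "\<dots> = (\<Sum>h\<in>I \<rightarrow>\<^sub>E V.
      \<Sum>\<sigma>\<in>{\<sigma>. \<sigma> permutes I \<and> (\<forall>i\<in>I. g (\<sigma> i) = h i)}. \<Prod>j\<in>I. c j (h j))"
  proof (intro sum.cong refl)
    fix h assume h: "h \<in> I \<rightarrow>\<^sub>E V"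
    show "{\<sigma> \<in> {\<sigma>. \<sigma> permutes I}. (\<lambda>i\<in>I. g (\<sigma> i)) = h}
        = {\<sigma>. \<sigma> permutes I \<and> (\<forall>i\<in>I. g (\<sigma> i) = h i)}"
      using h by (auto simp: fun_eq_iff PiE_def extensional_def)
  qed (auto intro!: prod.cong)
  finally show ?thesis by simp
qed

text \<open>Modulo \<open>d + 1\<close> only the row assignment \<open>t\<close> survives, and in
  its term only the column assignment \<open>t\<close>. The disjunction in \<open>unique\<close>
  covers both uses: rows are tested by \<open>r\<close>, columns by \<open>c\<close>.\<close>

lemma permanent_not_dvd:
  fixes r c :: "'i \<Rightarrow> 'v \<Rightarrow> int" and d :: nat
  assumes "finite I" "finite V" and prime: "prime (d + 1)"
    and t: "t \<in> I \<rightarrow>\<^sub>E V" "\<And>v. v \<in> V \<Longrightarrow> card {i \<in> I. t i = v} = d"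
    and unique: "\<And>g. g \<in> I \<rightarrow>\<^sub>E V \<Longrightarrow> (\<And>v. v \<in> V \<Longrightarrow> card {i \<in> I. g i = v} = d)
      \<Longrightarrow> (\<forall>i\<in>I. r i (g i) \<noteq> 0) \<or> (\<forall>i\<in>I. c i (g i) \<noteq> 0) \<Longrightarrow> g = t"
    and rt: "\<And>i. i \<in> I \<Longrightarrow> \<bar>r i (t i)\<bar> = 1" and ct: "\<And>i. i \<in> I \<Longrightarrow> \<bar>c i (t i)\<bar> = 1"
  shows "\<not> int (d + 1) dvd permanent (\<lambda>i j. \<Sum>v\<in>V. r i v * c j v) I"
proof
  \<comment> \<open>\<open>N g h\<close> is 0 or the product of the factorials of the fibre sizes of
    \<open>g\<close>; \<open>K g\<close> is the column contribution to the row assignment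
    \<open>g\<close>.\<close>
  define N where "N g h = card {\<sigma>. \<sigma> permutes I \<and> (\<forall>i\<in>I. g (\<sigma> i) = h i)}" for g h :: "'i \<Rightarrow> 'v"
  define K where "K g = (\<Sum>h\<in>I \<rightarrow>\<^sub>E V. int (N g h) * (\<Prod>j\<in>I. c j (h j)))" for g
  have finP: "finite (I \<rightarrow>\<^sub>E V)" using assms(1,2) by (intro finite_PiE) auto
  have fiber_sum: "(\<Sum>v\<in>V. card {i \<in> I. g i = v}) = card I" if "g \<in> I \<rightarrow>\<^sub>E V" for g
    using sum.group[OF assms(1,2), of g "\<lambda>_. 1::nat"] that by fastforce
  have perm: "permanent (\<lambda>i j. \<Sum>v\<in>V. r i v * c j v) I
      = (\<Sum>g\<in>I \<rightarrow>\<^sub>E V. (\<Prod>i\<in>I. r i (g i)) * K g)"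
    unfolding permanent_product_expansion[OF assms(1,2)] K_def N_def
    using assms(1,2) by (intro sum.cong refl arg_cong2[where f="(*)"] sum_over_permutations_by_composite) auto
  have N: "N g h = (\<Prod>v\<in>V. fact (card {i \<in> I. g i = v}))" if "g \<in> I \<rightarrow>\<^sub>E V" "N g h \<noteq> 0" for g h
  proof -
    have "{\<sigma>. \<sigma> permutes I \<and> (\<forall>i\<in>I. g (\<sigma> i) = h i)} \<noteq> {}"
      using that(2) unfolding N_def by (intro notI) simp
    then obtain \<tau> where \<tau>: "\<tau> permutes I" "\<forall>i\<in>I. g (\<tau> i) = h i" by blast
    have "g ` I \<subseteq> V" using that(1) by auto
    then show ?thesis
      unfolding N_def using assms(1,2) \<tau> by (intro card_permutations_transporting)
  qed
  have bad: "int (d + 1) dvd (\<Prod>i\<in>I. r i (g i)) * K g" if g: "g \<in> (I \<rightarrow>\<^sub>E V) - {t}" for g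
  proof (cases "\<exists>v\<in>V. card {i \<in> I. g i = v} > d")
    case True
    then obtain v where v: "v \<in> V" "card {i \<in> I. g i = v} \<ge> d + 1" by force
    have "int (d + 1) dvd int (N g h)" for h
    proof (cases "N g h = 0")
      case False
      have "d + 1 dvd fact (card {i \<in> I. g i = v})"
        using v by (intro dvd_fact) auto
      also have "\<dots> dvd (\<Prod>v\<in>V. fact (card {i \<in> I. g i = v}))"
        using v(1) assms(2) by (intro dvd_prodI) auto
      finally have "d + 1 dvd N g h" using N[of g h] False g by simp
      then show ?thesis by (simp only: of_nat_dvd_iff)
    qed simp
    then show ?thesis
      unfolding K_def by (intro dvd_mult dvd_sum dvd_mult2)
  next
    case False
    \<comment> \<open>No fibre exceeds \<open>d\<close>, and the sizes have the same total
      \<open>card I\<close> as for \<open>t\<close>. Hence every fibre has exactly \<open>d\<close>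
      elements.\<close>
    then have le: "card {i \<in> I. g i = v} \<le> card {i \<in> I. t i = v}" if "v \<in> V" for v
      using t(2) that by fastforce
    have eq: "(\<Sum>v\<in>V. card {i \<in> I. g i = v}) = (\<Sum>v\<in>V. card {i \<in> I. t i = v})"
      using fiber_sum g t(1) by auto
    then have "card {i \<in> I. g i = v} = d" if "v \<in> V" for v
      using sum_mono_inv[OF eq le that assms(2)] t(2)[OF that] by simp
    then have "\<exists>i\<in>I. r i (g i) = 0" using unique[of g] g by auto
    then have "(\<Prod>i\<in>I. r i (g i)) = 0" using assms(1) by auto
    then show ?thesis by simp
  qed
  have Kt: "K t = int (fact d ^ card V) * (\<Prod>j\<in>I. c j (t j))"
  proof -
    have "K t = (\<Sum>h\<in>{t}. int (N t h) * (\<Prod>j\<in>I. c j (h j)))"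
      unfolding K_def
    proof (intro sum.mono_neutral_right ballI)
      fix h assume h: "h \<in> (I \<rightarrow>\<^sub>E V) - {t}"
      show "int (N t h) * (\<Prod>j\<in>I. c j (h j)) = 0"
      proof (cases "N t h = 0")
        case False
        then have "{\<sigma>. \<sigma> permutes I \<and> (\<forall>i\<in>I. t (\<sigma> i) = h i)} \<noteq> {}"
          unfolding N_def by (intro notI) simp
        then obtain \<sigma> where \<sigma>: "\<sigma> permutes I" "\<forall>i\<in>I. t (\<sigma> i) = h i" by blast
        \<comment> \<open>On \<open>I\<close>, \<open>h\<close> is \<open>t\<close> preceded by a
          permutation, so its fibre sizes are those of \<open>t\<close> and \<open>unique\<close>
          applies to it.\<close>
        have "card {i \<in> I. h i = v} = card {i \<in> I. t i = v}" for v
        proof -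
          have "{i \<in> I. h i = v} = {i \<in> I. t (\<sigma> i) = v}" using \<sigma>(2) by auto
          moreover have "\<sigma> ` {i \<in> I. t (\<sigma> i) = v} = {i \<in> \<sigma> ` I. t i = v}" by auto
          moreover have "card (\<sigma> ` {i \<in> I. t (\<sigma> i) = v}) = card {i \<in> I. t (\<sigma> i) = v}"
            by (rule card_image[OF permutes_inj_on[OF \<sigma>(1)]])
          ultimately show ?thesis by (simp add: permutes_image[OF \<sigma>(1)])
        qed
        then have "\<exists>i\<in>I. c i (h i) = 0" using unique[of h] h t(2) by auto
        then show ?thesis using assms(1) by auto
      qed simp
    qed (use finP t(1) in auto)
    moreover have "N t t = fact d ^ card V"
    proof -
      have "N t t = (\<Prod>v\<in>V. fact (card {i \<in> I. t i = v}))"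
        unfolding N_def using t(1) assms(1,2) by (intro card_fiber_preserving_permutations) auto
      then show ?thesis using t(2) by simp
    qed
    ultimately show ?thesis by simp
  qed
  assume "int (d + 1) dvd permanent (\<lambda>i j. \<Sum>v\<in>V. r i v * c j v) I"
  then have "int (d + 1) dvd (\<Prod>i\<in>I. r i (t i)) * K t + (\<Sum>g\<in>(I \<rightarrow>\<^sub>E V) - {t}. (\<Prod>i\<in>I. r i (g i)) * K g)"
    by (simp only: perm sum.remove[OF finP t(1)])
  moreover have "int (d + 1) dvd (\<Sum>g\<in>(I \<rightarrow>\<^sub>E V) - {t}. (\<Prod>i\<in>I. r i (g i)) * K g)"
    using bad by (intro dvd_sum) auto
  ultimately have "int (d + 1) dvd (\<Prod>i\<in>I. r i (t i)) * K t"
    by (simp only: dvd_add_left_iff)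
  then have "int (d + 1) dvd \<bar>(\<Prod>i\<in>I. r i (t i)) * K t\<bar>" by simp
  also have "\<bar>(\<Prod>i\<in>I. r i (t i)) * K t\<bar> = int (fact d ^ card V)"
    using rt ct by (simp add: Kt abs_mult abs_prod)
  finally have "d + 1 dvd fact d ^ card V" by (simp only: of_nat_dvd_iff)
  \<comment> \<open>Primality passes from the power to \<open>d!\<close>, all of whose factors are
    smaller than \<open>d + 1\<close>.\<close>
  then have "d + 1 dvd fact d" using prime prime_dvd_power by blast
  then show False using prime by (simp add: prime_dvd_fact_iff)
qed

section \<open>From a nonzero permanent to a proper weighting\<close>

lemma finite_edges: "simple_graph X \<Longrightarrow> finite (edges X)"
  unfolding simple_graph_def by (rule finite_subset[of _ "Pow (verts X)"]) auto

text \<open>Row \<open>i\<close> is the form "sum at the tail minus sum at the head" in the edge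
  weights, so an endpoint shared with edge \<open>j\<close> contributes 1 or -1. Vertex lists have
  one element, so vertex weights enter as constants only. The bijection \<open>\<beta>\<close>
  allows edges to be named by other indices.\<close>

lemma total_choosable_if_permanent_nonzero:
  fixes X :: "'b graph" and \<beta> :: "'i \<Rightarrow> 'b set"
  assumes X: "simple_graph X" and \<beta>: "bij_betw \<beta> I (edges X)"
    and tail: "\<And>e. e \<in> edges X \<Longrightarrow> tail e \<in> e"
    and nz: "permanent (\<lambda>i j. \<Sum>w\<in>\<beta> i \<inter> \<beta> j. if w = tail (\<beta> i) then 1 else - 1 :: int) I \<noteq> 0"
  shows "total_choosable 1 2 X"
  unfolding total_choosable_def
proof (intro allI impI)
  fix L :: "'b + 'b set \<Rightarrow> real set"
  assume L: "(\<forall>v\<in>verts X. finite (L (Inl v)) \<and> card (L (Inl v)) = 1) \<and>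
    (\<forall>e\<in>edges X. finite (L (Inr e)) \<and> card (L (Inr e)) = 2)"
  define A :: "'i \<Rightarrow> 'i \<Rightarrow> real"
    where "A i j = of_int (\<Sum>w\<in>\<beta> i \<inter> \<beta> j. if w = tail (\<beta> i) then 1 else - 1)" for i j
  have finI: "finite I" using \<beta> finite_edges[OF X] bij_betw_finite by blast
  have \<beta>_in: "\<beta> i \<in> edges X" if "i \<in> I" for i using \<beta> that by (auto simp: bij_betw_def)
  have "\<forall>e\<in>edges X. \<exists>w. e = {tail e, w} \<and> w \<noteq> tail e"
  proof
    fix e assume e: "e \<in> edges X"
    then have "card e = 2" using X by (auto simp: simple_graph_def)
    then show "\<exists>w. e = {tail e, w} \<and> w \<noteq> tail e"
      using tail[OF e] unfolding card_2_iff by (metis insert_commute insertE singletonD)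
  qed
  then obtain head where head: "\<And>e. e \<in> edges X \<Longrightarrow> e = {tail e, head e} \<and> head e \<noteq> tail e"
    by metis
  have "\<forall>v\<in>verts X. \<exists>y. L (Inl v) = {y}" using L by (simp add: card_1_singleton_iff)
  then obtain y where y: "\<And>v. v \<in> verts X \<Longrightarrow> L (Inl v) = {y v}" by metis
  \<comment> \<open>Nonvanishing is known over the integers and is carried to the reals, where the
    lists live.\<close>
  have "permanent A I \<noteq> 0"
    unfolding A_def using nz by (simp only: of_int_permanent[symmetric] of_int_eq_0_iff not_False_eq_True)
  then obtain x where x: "\<And>j. j \<in> I \<Longrightarrow> x j \<in> L (Inr (\<beta> j))"
    and avoids: "\<And>i. i \<in> I \<Longrightarrow> (\<Sum>j\<in>I. A i j * x j) + (y (tail (\<beta> i)) - y (head (\<beta> i))) \<noteq> 0"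
  proof (rule permanent_nonzero_avoids_zeros[OF finI, where c = "\<lambda>i. y (tail (\<beta> i)) - y (head (\<beta> i))"])
    show "card (L (Inr (\<beta> j))) = 2" if "j \<in> I" for j using L \<beta>_in[OF that] by blast
  qed (use that in blast)
  define \<phi> where "\<phi> z = (case z of Inl v \<Rightarrow> y v | Inr e \<Rightarrow> x (the_inv_into I \<beta> e))" for z
  have \<phi>\<beta>: "\<phi> (Inr (\<beta> j)) = x j" if "j \<in> I" for j
    using \<beta> that by (simp add: \<phi>_def the_inv_into_f_f bij_betw_def)
  have vsum: "vertex_sum X \<phi> v = (\<Sum>j\<in>I. if v \<in> \<beta> j then x j else 0) + y v" for v
  proof -
    have "(\<Sum>e\<in>incident_edges X v. \<phi> (Inr e)) = (\<Sum>e\<in>edges X. if v \<in> e then \<phi> (Inr e) else 0)"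
      using finite_edges[OF X]
      by (intro sum.mono_neutral_cong_left) (auto simp: incident_edges_def)
    also have "\<dots> = (\<Sum>j\<in>I. if v \<in> \<beta> j then \<phi> (Inr (\<beta> j)) else 0)"
      by (rule sum.reindex_bij_betw[OF \<beta>, symmetric])
    also have "\<dots> = (\<Sum>j\<in>I. if v \<in> \<beta> j then x j else 0)"
      using \<phi>\<beta> by (intro sum.cong) auto
    finally show ?thesis by (simp add: vertex_sum_def \<phi>_def)
  qed
  have ends_differ: "vertex_sum X \<phi> (tail e) \<noteq> vertex_sum X \<phi> (head e)" if e: "e \<in> edges X" for e
  proof -
    obtain i where i: "i \<in> I" "\<beta> i = e" using \<beta> e by (metis bij_betw_imp_surj_on imageE)
    have ends: "\<beta> i = {tail e, head e}" "head e \<noteq> tail e" by (metis head[OF e] i(2))+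
    have "A i j * x j = (if tail e \<in> \<beta> j then x j else 0) - (if head e \<in> \<beta> j then x j else 0)" for j
    proof -
      \<comment> \<open>The tail counts 1 and the head -1, each exactly if it lies on edge
        \<open>j\<close>; for \<open>j = i\<close> the two cancel.\<close>
      have "\<beta> i \<inter> \<beta> j = (if tail e \<in> \<beta> j then {tail e} else {}) \<union> (if head e \<in> \<beta> j then {head e} else {})"
        by (auto simp: ends(1))
      then show ?thesis using ends(2) by (auto simp: A_def i(2))
    qed
    then have "vertex_sum X \<phi> (tail e) - vertex_sum X \<phi> (head e)
        = (\<Sum>j\<in>I. A i j * x j) + (y (tail (\<beta> i)) - y (head (\<beta> i)))"
      by (simp add: vsum sum_subtractf i(2))
    then show ?thesis using avoids[OF i(1)] by simp
  qed
  have "proper_total_weighting X \<phi>"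
    unfolding proper_total_weighting_def
  proof (intro allI impI)
    fix u v assume uv: "{u, v} \<in> edges X"
    show "vertex_sum X \<phi> u \<noteq> vertex_sum X \<phi> v"
      using ends_differ[OF uv] head[OF uv] by (metis doubleton_eq_iff)
  qed
  moreover have "\<phi> z \<in> L z" if "z \<in> verts X <+> edges X" for z
  proof (cases z)
    case (Inl v)
    then show ?thesis using that y by (auto simp: \<phi>_def)
  next
    case (Inr e)
    then have "e \<in> \<beta> ` I" using that \<beta> by (auto simp: bij_betw_def)
    then obtain j where "j \<in> I" "e = \<beta> j" by blast
    then show ?thesis using x \<phi>\<beta> Inr by simp
  qed
  ultimately show "\<exists>\<phi>. proper_total_weighting X \<phi> \<and> (\<forall>z\<in>verts X <+> edges X. \<phi> z \<in> L z)"
    by blast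
qed

theorem theorem7:
  fixes d :: nat and G :: "'a graph" and vs :: "'a list"
  assumes "d > 0" and "prime (d + 1)"
    and "simple_graph G" and "degenerate d G"
    and "vertex_ordering G vs"
    and "\<And>i. i < length vs \<Longrightarrow> back_degree G vs i \<le> d"
  shows "\<exists>m :: 'a \<Rightarrow> nat.
           (\<forall>i < length vs. m (vs ! i) \<le> d - back_degree G vs i) \<and>
           total_choosable 1 2 (add_leaves m G)"
proof -

  \<comment> \<open>The ordering, the half-edges and their matrix\<close>
  let ?V = "verts G" and ?E = "edges G"
  have distinct: "distinct vs" and set_vs: "set vs = ?V"
    using assms(5) by (auto simp: vertex_ordering_def)
  have finV: "finite ?V" using assms(3) by (simp add: simple_graph_def)
  have edge: "e \<subseteq> ?V" "card e = 2" if "e \<in> ?E" for e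
    using assms(3) that by (auto simp: simple_graph_def)
  define pos where "pos = the_inv_into {..<length vs} ((!) vs)"
  have inj_nth: "inj_on ((!) vs) {..<length vs}" using distinct by (simp add: inj_on_nth)
  have pos_nth: "pos (vs ! i) = i" if "i < length vs" for i
    using the_inv_into_f_f[OF inj_nth] that by (simp add: pos_def)
  have pos: "pos v < length vs" "vs ! pos v = v" if "v \<in> ?V" for v
    using that pos_nth by (metis in_set_conv_nth set_vs)+
  \<comment> \<open>This yields \<open>top S\<close>, the last vertex of \<open>S\<close> in the
    ordering: the later endpoint of an edge, or the only vertex of a half-edge.\<close>
  have "\<exists>m\<in>S. \<forall>u\<in>S. pos u \<le> pos m" if "S \<subseteq> ?V" "S \<noteq> {}" for S
  proof -
    have "finite (pos ` S)" using that(1) finV finite_subset by blast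
    then have "Max (pos ` S) \<in> pos ` S" "\<forall>u\<in>S. pos u \<le> Max (pos ` S)" using that(2) by auto
    then show ?thesis by force
  qed
  then obtain top where top: "\<And>S. S \<subseteq> ?V \<Longrightarrow> S \<noteq> {} \<Longrightarrow> top S \<in> S"
    and top_max: "\<And>S u. S \<subseteq> ?V \<Longrightarrow> u \<in> S \<Longrightarrow> pos u \<le> pos (top S)"
    by (metis empty_iff)
  have top_single: "top {v} = v" if "v \<in> ?V" for v using top[of "{v}"] that by simp
  define s where "s v = d - back_degree G vs (pos v)" for v
  \<comment> \<open>An index is an edge or a half-edge \<open>Inr (v, j)\<close>, the one numbered
    \<open>j\<close> at \<open>v\<close>; \<open>supp\<close> is the set of its vertices in
    \<open>G\<close>.\<close>
  define supp :: "'a set + 'a \<times> nat \<Rightarrow> 'a set"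
    where "supp = case_sum (\<lambda>e. e) (\<lambda>(v, j). {v})"
  have supp_simps [simp]: "supp (Inl e) = e" "supp (Inr (v, j)) = {v}" for e v j
    by (auto simp: supp_def)
  define H :: "('a set + 'a \<times> nat) set" where "H = Inr ` (SIGMA v:?V. {..<s v})"
  define I where "I = Inl ` ?E \<union> H"
  define t where "t = (\<lambda>i\<in>I. top (supp i))"
  \<comment> \<open>Rows are signed "later minus earlier endpoint", which puts \<open>1 - 1\<close>
    on the diagonal for an edge; a half-edge has only its top vertex, hence 1. \<open>r\<close> and
    \<open>c\<close> factor the matrix \<open>N\<close> through the vertices.\<close>
  define sg :: "'a set + 'a \<times> nat \<Rightarrow> 'a \<Rightarrow> int"
    where "sg i v = (if v = top (supp i) then 1 else - 1)" for i v
  define r where "r i v = (if v \<in> supp i then sg i v else 0)" for i v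
  define c :: "'a set + 'a \<times> nat \<Rightarrow> 'a \<Rightarrow> int"
    where "c i v = (if v \<in> supp i then 1 else 0)" for i v
  define N where "N i j = (\<Sum>v\<in>?V. r i v * c j v)" for i j
  have finH: "finite H" using finV by (simp add: H_def)
  have finI: "finite I" using finH finite_edges[OF assms(3)] by (simp add: I_def)
  have H_sub: "H \<subseteq> I" by (simp add: I_def)
  have supp: "supp i \<subseteq> ?V" "supp i \<noteq> {}" if "i \<in> I" for i
    using that edge by (fastforce simp: I_def H_def)+
  have t_in: "t \<in> I \<rightarrow>\<^sub>E ?V"
    unfolding t_def using top[OF supp] supp(1) by (intro restrict_PiE_iff[THEN iffD2]) blast
  have N_eq: "N i j = (\<Sum>v\<in>supp i \<inter> supp j. sg i v)" if "i \<in> I" for i j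
    unfolding N_def r_def c_def
    using finV supp(1)[OF that] by (intro sum.mono_neutral_cong_right) auto

  \<comment> \<open>The assignment to later endpoints and its uniqueness\<close>
  have fiber: "card {i \<in> I. t i = v} = d" if v: "v \<in> ?V" for v
  proof -
    define B where "B = {vs ! j |j. j < pos v \<and> {vs ! j, vs ! pos v} \<in> ?E}"
    have B: "B = {u \<in> ?V. pos u < pos v \<and> {u, v} \<in> ?E}"
    proof (intro set_eqI iffI)
      fix u assume "u \<in> B"
      then obtain j where "u = vs ! j" "j < pos v" "{u, v} \<in> ?E" using pos[OF v] by (auto simp: B_def)
      moreover have "j < length vs" using \<open>j < pos v\<close> pos(1)[OF v] by simp
      ultimately show "u \<in> {u \<in> ?V. pos u < pos v \<and> {u, v} \<in> ?E}"
        using pos_nth set_vs nth_mem by fastforce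
    next
      fix u assume "u \<in> {u \<in> ?V. pos u < pos v \<and> {u, v} \<in> ?E}"
      then show "u \<in> B" using pos v by (auto simp: B_def intro!: exI[of _ "pos u"])
    qed
    \<comment> \<open>The edges with later endpoint \<open>v\<close> correspond to the backward
      neighbours of \<open>v\<close>; the half-edges at \<open>v\<close> fill the fibre up to
      \<open>d\<close>.\<close>
    have "{e \<in> ?E. top e = v} = (\<lambda>u. {u, v}) ` B"
    proof (intro set_eqI iffI)
      fix e assume "e \<in> {e \<in> ?E. top e = v}"
      then have e: "e \<in> ?E" "top e = v" by auto
      then have "v \<in> e" using top[of e] edge[OF e(1)] by fastforce
      then obtain u where u: "e = {u, v}" "u \<noteq> v"
        using edge(2)[OF e(1)] unfolding card_2_iff by blast
      then have "u \<in> ?V" using edge(1)[OF e(1)] by auto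
      moreover have "pos u \<le> pos v" using top_max[of e u] edge(1)[OF e(1)] e(2) u by auto
      moreover have "pos u \<noteq> pos v" using pos(2) u(2) v \<open>u \<in> ?V\<close> by metis
      ultimately show "e \<in> (\<lambda>u. {u, v}) ` B" using u e(1) by (auto simp: B)
    next
      fix e assume "e \<in> (\<lambda>u. {u, v}) ` B"
      then obtain u where u: "e = {u, v}" "u \<in> ?V" "pos u < pos v" "e \<in> ?E" by (auto simp: B)
      then have "top e \<in> e" "pos v \<le> pos (top e)"
        using top[of e] top_max[of e v] v by auto
      then show "e \<in> {e \<in> ?E. top e = v}" using u by auto
    qed
    moreover have "inj_on (\<lambda>u. {u, v}) B" by (auto simp: inj_on_def doubleton_eq_iff)
    ultimately have "card {e \<in> ?E. top e = v} = back_degree G vs (pos v)"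
      by (simp add: card_image back_degree_def B_def)
    \<comment> \<open>The bound on the backward degree makes the truncated subtraction in
      \<open>s\<close> exact.\<close>
    then have "card {e \<in> ?E. top e = v} + s v = d"
      using assms(6) pos(1)[OF v] by (simp add: s_def)
    moreover have "{i \<in> I. t i = v} = {e \<in> ?E. top e = v} <+> (\<lambda>j. (v, j)) ` {..<s v}"
      using v by (auto simp: I_def H_def t_def top_single Plus_def)
    moreover have "card ((\<lambda>j. (v, j)) ` {..<s v}) = s v"
      by (simp add: card_image inj_on_def)
    ultimately show ?thesis
      using finite_edges[OF assms(3)] by (simp add: card_Plus)
  qed
  have unique: "g = t" if g: "g \<in> I \<rightarrow>\<^sub>E ?V" "\<And>v. v \<in> ?V \<Longrightarrow> card {i \<in> I. g i = v} = d"
    and compatible: "(\<forall>i\<in>I. r i (g i) \<noteq> 0) \<or> (\<forall>i\<in>I. c i (g i) \<noteq> 0)" for g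
  proof -
    \<comment> \<open>With all fibres of size \<open>d\<close> the sum of positions is fixed, and \<open>t\<close> maximises it termwise.\<close>
    have pos_sum: "(\<Sum>i\<in>I. pos (f i)) = (\<Sum>v\<in>?V. d * pos v)"
      if "f \<in> I \<rightarrow>\<^sub>E ?V" "\<And>v. v \<in> ?V \<Longrightarrow> card {i \<in> I. f i = v} = d" for f
    proof -
      have "(\<Sum>i\<in>I. pos (f i)) = (\<Sum>v\<in>?V. \<Sum>i\<in>{i \<in> I. f i = v}. pos (f i))"
        using finI finV that(1) by (intro sum.group[symmetric]) auto
      also have "\<dots> = (\<Sum>v\<in>?V. d * pos v)" using that(2) by (intro sum.cong) auto
      finally show ?thesis .
    qed
    \<comment> \<open>Either kind of nonvanishing forces every index to be sent to one of its own
      vertices.\<close>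
    have "g i \<in> supp i" if "i \<in> I" for i
      using compatible that by (auto simp: r_def c_def split: if_splits)
    then have "pos (g i) \<le> pos (t i)" if "i \<in> I" for i
      using top_max[OF supp(1)[OF that]] that by (simp add: t_def)
    moreover have "(\<Sum>i\<in>I. pos (g i)) = (\<Sum>i\<in>I. pos (t i))"
      using pos_sum[OF g] pos_sum[OF t_in fiber] by simp
    ultimately have "pos (g i) = pos (t i)" if "i \<in> I" for i
      using sum_mono_inv[of "\<lambda>i. pos (g i)" I "\<lambda>i. pos (t i)"] that finI by blast
    then have "g i = t i" if "i \<in> I" for i
      using that g(1) t_in pos(2) by (metis PiE_mem)
    then show ?thesis using g(1) t_in by (rule PiE_ext[rotated 2])
  qed

  \<comment> \<open>Replacing half-edges by leaf edges\<close>
  have "\<not> int (d + 1) dvd permanent N I"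
    unfolding N_def
  proof (rule permanent_not_dvd[OF finI finV assms(2) t_in fiber unique])
    fix i assume "i \<in> I"
    then show "\<bar>r i (t i)\<bar> = 1" "\<bar>c i (t i)\<bar> = 1"
      using top supp by (auto simp: r_def c_def t_def sg_def)
  qed
  moreover have "N h h = 1" if "h \<in> H" for h
  proof -
    have "h \<in> I" using that H_sub by blast
    then show ?thesis using that by (auto simp: N_eq H_def sg_def top_single)
  qed
  \<comment> \<open>Not being divisible by \<open>d + 1\<close>, the permanent of \<open>N\<close>
    is nonzero, so some set \<open>F\<close> of deleted half-edges gives a nonzero summand.\<close>
  ultimately have "(\<Sum>F\<in>Pow H. permanent (\<lambda>i j. if i = j \<and> i \<in> H then 0 else N i j) (I - F)) \<noteq> 0"
    using permanent_unit_diagonal[OF finI H_sub, of N] by auto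
  then obtain F where F: "F \<subseteq> H"
    and nz: "permanent (\<lambda>i j. if i = j \<and> i \<in> H then 0 else N i j) (I - F) \<noteq> 0"
    by (metis (no_types, lifting) Pow_iff sum.neutral)
  \<comment> \<open>\<open>J v\<close> lists the half-edges at \<open>v\<close> that survive. They
    are renumbered by \<open>b v\<close>, since \<open>add_leaves\<close> numbers leaves
    consecutively from 0.\<close>
  define J where "J v = {j. j < s v \<and> Inr (v, j) \<notin> F}" for v
  define m where "m v = card (J v)" for v
  have finJ: "finite (J v)" for v by (simp add: J_def)
  obtain b where b: "\<And>v. bij_betw (b v) (J v) {..<m v}"
    using ex_bij_betw_finite_nat[OF finJ] unfolding m_def atLeast0LessThan by metis
  define \<beta> :: "'a set + 'a \<times> nat \<Rightarrow> ('a + 'a \<times> nat) set"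
    where "\<beta> = case_sum (\<lambda>e. Inl ` e) (\<lambda>(v, j). {Inl v, Inr (v, b v j)})"
  have \<beta>_simps [simp]: "\<beta> (Inl e) = Inl ` e" "\<beta> (Inr (v, j)) = {Inl v, Inr (v, b v j)}" for e v j
    by (auto simp: \<beta>_def)
  have IF: "I - F = Inl ` ?E \<union> Inr ` (SIGMA v:?V. J v)"
    using F by (auto simp: I_def H_def J_def)
  have inj_Inl: "Inl ` e = Inl ` e' \<longleftrightarrow> e = e'" for e e' :: "'a set"
    by (simp add: inj_image_eq_iff)
  have bij: "bij_betw \<beta> (I - F) (edges (add_leaves m G))"
    unfolding bij_betw_def
  proof
    have "Inl ` e \<noteq> {Inl v, Inr (v, k)}" for e and v :: 'a and k :: nat by auto
    moreover have "j = j'" if "v \<in> ?V" "j \<in> J v" "j' \<in> J v" "b v j = b v j'" for v j j'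
      using b[of v] that by (auto simp: bij_betw_def dest: inj_onD)
    ultimately show "inj_on \<beta> (I - F)"
      unfolding IF by (intro inj_onI) (auto simp: inj_Inl doubleton_eq_iff)
    have "b v ` J v = {..<m v}" for v using b[of v] by (simp add: bij_betw_def)
    then have "k < m v \<longleftrightarrow> (\<exists>j\<in>J v. k = b v j)" for v k by (metis imageE imageI lessThan_iff)
    then have "{{Inl v, Inr (v, j)} |v j. v \<in> ?V \<and> j < m v}
      = {{Inl v, Inr (v, b v j)} |v j. v \<in> ?V \<and> j \<in> J v}"
      by auto
    also have "\<dots> = \<beta> ` Inr ` (SIGMA v:?V. J v)"
      unfolding image_image by (auto simp: image_def)
    finally show "\<beta> ` (I - F) = edges (add_leaves m G)"
      unfolding IF add_leaves_def by (simp add: image_Un image_image)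
  qed
  \<comment> \<open>The vertices of \<open>G\<close> on the edge \<open>\<beta> i\<close> are those
    of the index \<open>i\<close>, so their top vertex can serve as tail; on a leaf edge this is the
    old vertex.\<close>
  have supp_\<beta>: "Inl -` \<beta> i = supp i" for i
    by (cases i) (auto simp: vimage_def split: prod.splits)
  have tail: "Inl (top (Inl -` e)) \<in> e" if "e \<in> edges (add_leaves m G)" for e
  proof -
    have "e \<in> \<beta> ` (I - F)" using bij that by (simp add: bij_betw_def)
    then obtain i where "i \<in> I" "e = \<beta> i" by auto
    then have "top (supp i) \<in> Inl -` \<beta> i" using top[OF supp] by (simp only: supp_\<beta>)
    then have "Inl (top (supp i)) \<in> \<beta> i" by (rule vimageD)
    then show ?thesis by (simp add: \<open>e = \<beta> i\<close> supp_\<beta>)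
  qed
  \<comment> \<open>A leaf lies on a single edge, so it affects only the diagonal, where its -1
    cancels the 1 of the old vertex. All other entries involve vertices of \<open>G\<close> alone
    and agree with \<open>N\<close>.\<close>
  have matrix: "(\<Sum>w\<in>\<beta> i \<inter> \<beta> j. if w = Inl (top (Inl -` \<beta> i)) then 1 else - 1 :: int)
      = (if i = j \<and> i \<in> H then 0 else N i j)" if ij: "i \<in> I - F" "j \<in> I - F" for i j
  proof (cases "i = j \<and> i \<in> H")
    case True
    then obtain v k where "i = Inr (v, k)" "j = Inr (v, k)" "v \<in> ?V" by (auto simp: H_def)
    moreover have "Inl -` {Inl v, Inr (v, b v k)} = {v}" by auto
    ultimately show ?thesis using True by (auto simp: top_single)
  next
    case False
    have "\<beta> i \<inter> \<beta> j = Inl ` (supp i \<inter> supp j)"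
    proof (intro set_eqI)
      fix w
      show "w \<in> \<beta> i \<inter> \<beta> j \<longleftrightarrow> w \<in> Inl ` (supp i \<inter> supp j)"
      proof (cases w)
        case (Inl v)
        have "Inl v \<in> \<beta> i \<longleftrightarrow> v \<in> supp i" for i
          unfolding supp_\<beta>[of i, symmetric] by (rule vimage_eq[symmetric])
        then show ?thesis by (auto simp: Inl)
      next
        case (Inr q)
        obtain v k where q: "q = (v, k)" by (cases q)
        have leaf: "\<exists>k'. i = Inr (v, k') \<and> b v k' = k" if "Inr (v, k) \<in> \<beta> i" for v k i
          using that by (cases i) (auto simp: \<beta>_def split: prod.splits)
        have "w \<notin> \<beta> i \<inter> \<beta> j"
        proof
          assume "w \<in> \<beta> i \<inter> \<beta> j"
          then have w: "Inr (v, k) \<in> \<beta> i" "Inr (v, k) \<in> \<beta> j" by (simp_all add: Inr q)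
          obtain k1 where k1: "i = Inr (v, k1)" "b v k1 = k" using leaf[OF w(1)] by blast
          obtain k2 where k2: "j = Inr (v, k2)" "b v k2 = k" using leaf[OF w(2)] by blast
          have "k1 \<in> J v" "k2 \<in> J v" using ij k1(1) k2(1) by (auto simp: IF)
          moreover have "inj_on (b v) (J v)" using b[of v] by (simp add: bij_betw_def)
          ultimately have "k1 = k2" using k1(2) k2(2) by (metis inj_onD)
          then have "i = j" "i \<in> H" using k1(1) k2(1) ij(1) by (auto simp: I_def)
          then show False using False by simp
        qed
        then show ?thesis using Inr by auto
      qed
    qed
    then have "(\<Sum>w\<in>\<beta> i \<inter> \<beta> j. if w = Inl (top (Inl -` \<beta> i)) then 1 else - 1 :: int)
        = (\<Sum>v\<in>supp i \<inter> supp j. sg i v)"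
      by (simp add: sum.reindex supp_\<beta> sg_def)
    then show ?thesis using ij False by (auto simp: N_eq)
  qed
  have "total_choosable 1 2 (add_leaves m G)"
  proof (rule total_choosable_if_permanent_nonzero[OF simple_graph_add_leaves[OF assms(3)] bij tail])
    have "permanent (\<lambda>i j. \<Sum>w\<in>\<beta> i \<inter> \<beta> j. if w = Inl (top (Inl -` \<beta> i)) then 1 else - 1) (I - F)
        = permanent (\<lambda>i j. if i = j \<and> i \<in> H then 0 else N i j) (I - F)"
      by (rule permanent_cong) (rule matrix)
    then show "permanent (\<lambda>i j. \<Sum>w\<in>\<beta> i \<inter> \<beta> j.
        if w = Inl (top (Inl -` \<beta> i)) then 1 else - 1 :: int) (I - F) \<noteq> 0"
      using nz by simp
  qed
  moreover have "m (vs ! i) \<le> d - back_degree G vs i" if "i < length vs" for i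
  proof -
    \<comment> \<open>The leaves at a vertex come from a subset of its half-edges.\<close>
    have "m (vs ! i) \<le> card {..<s (vs ! i)}"
      unfolding m_def by (intro card_mono) (auto simp: J_def)
    then show ?thesis using pos_nth[OF that] by (simp add: s_def)
  qed
  ultimately show ?thesis by blast
qed

end
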